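(* Let $n\ge 1$ be an integer. (i) For every $n$-multiset center $\widetilde{\mathfrak Z}_n:\widetilde{\mathcal F}_n\to\mathbb R^2$ and every $\widetilde P\in\widetilde{\mathcal F}_n$, the point $\widetilde{\mathfrak Z}_n(\widetilde P)$ belongs to the set of points fixed by the group of symmetries of $\widetilde P$. (ii) Conversely, for every $\widetilde P\in\widetilde{\mathcal P}_n$ and every point $X\in\mathbb R^2$ in the set of points fixed by the group of symmetries of $\widetilde P$, there exists an $n$-multiset center $\widetilde{\mathfrak Z}_n:\widetilde{\mathcal P}_n\to\mathbb R^2$, defined on all of $\widetilde{\mathcal P}_n$, such that $\widetilde{\mathfrak Z}_n(\widetilde P)=X$.
   Context: $\widetilde{\mathcal P}_n$ denotes the set of all $n$-multisets, i.e. multisets $\{V_1,\dots,V_n\}$ of $n$ points of $\mathbb R^2$ counted with multiplicity (repetitions allowed, order irrelevant). $E(2)$ is the group of rigid motions (isometries, including reflections) of the plane and $S(2)\supset E(2)$ the group of similarities of the plane. A similarity $T\in S(2)$ acts on $\widetilde{\mathcal P}_n$ by $T(\{V_1,\dots,V_n\})=\{T(V_1),\dots,T(V_n)\}$. The group of symmetries of $\widetilde P\in\widetilde{\mathcal P}_n$ is the subgroup of all $T\in E(2)$ with $T(\widetilde P)=\widetilde P$ (as multisets). A point $X\in\mathbb R^2$ is fixed by this group if $T(X)=X$ for every $T$ in it. An $n$-multiset center is a function $\widetilde{\mathfrak X}_n:\widetilde{\mathcal F}_n\to\mathbb R^2$, where $\widetilde{\mathcal F}_n$ is a non-empty subset of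 $\widetilde{\mathcal P}_n$ closed under the action of similarities, that commutes with similarities: $\widetilde{\mathfrak X}_n(T(\widetilde P))=T(\widetilde{\mathfrak X}_n(\widetilde P))$ for all $T\in S(2)$ and all $\widetilde P\in\widetilde{\mathcal F}_n$. *)

theory Defs
  imports "HOL-Analysis.Analysis" "HOL-Library.Multiset"
begin

type_synonym point = "real ^ 2"

definition similarities :: "(point \<Rightarrow> point) set" where
  "similarities = {T. bij T \<and> (\<exists>r>0. \<forall>x y. dist (T x) (T y) = r * dist x y)}"

definition rigid_motions :: "(point \<Rightarrow> point) set" where
  "rigid_motions = {T. bij T \<and> (\<forall>x y. dist (T x) (T y) = dist x y)}"

definition n_multisets :: "nat \<Rightarrow> point multiset set" where
  "n_multisets n = {P. size P = n}"

definition symmetries :: "point multiset \<Rightarrow> (point \<Rightarrow> point) set" where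
  "symmetries P = {T \<in> rigid_motions. image_mset T P = P}"

definition fixed_points :: "(point \<Rightarrow> point) set \<Rightarrow> point set" where
  "fixed_points G = {X. \<forall>T\<in>G. T X = X}"

(* A center with domain F is a total HOL function; its values outside F are irrelevant. *)
definition multiset_center ::
  "nat \<Rightarrow> point multiset set \<Rightarrow> (point multiset \<Rightarrow> point) \<Rightarrow> bool" where
  "multiset_center n F Z \<longleftrightarrow>
     F \<noteq> {} \<and> F \<subseteq> n_multisets n \<and>
     (\<forall>T\<in>similarities. \<forall>P\<in>F. image_mset T P \<in> F) \<and>
     (\<forall>T\<in>similarities. \<forall>P\<in>F. Z (image_mset T P) = T (Z P))"

end

theory Submission
  imports Defs
begin

text \<open>
  Part (i): a symmetry \<open>T\<close> of \<open>P\<close> is a similarity of ratio one, so equivariance of the center along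
  \<open>T\<close> reads \<open>Z P = Z (T P) = T (Z P)\<close>.

  Part (ii): equivariance forces the value \<open>T X\<close> at \<open>T P\<close>, and different orbits of the similarity
  group impose no conditions on each other. So take the forced values on the orbit of \<open>P\<close> and a
  known center, the centroid, everywhere else. What has to be shown is that the forced values are
  well defined, that is, that a \<^emph>\<open>similarity\<close> \<open>U\<close> with \<open>U P = P\<close> fixes \<open>X\<close>, although by hypothesis
  only the \<^emph>\<open>isometries\<close> with this property do. If the ratio of \<open>U\<close> is not one, then the sum of the
  distances from the points of \<open>P\<close> to the centroid \<open>c\<close>, which \<open>U\<close> fixes, is multiplied by that
  ratio and is also unchanged. Hence it is zero and \<open>P\<close> consists of copies of \<open>c\<close>.
  The point reflection in \<open>c\<close> is then a symmetry of \<open>P\<close>, so \<open>X = c\<close>, and \<open>U\<close> fixes \<open>c\<close>.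
  This argument is \<open>similarity_stabilizer_fixes\<close>.
\<close>

section \<open>The group of similarities\<close>

lemma similarityE:
  assumes "T \<in> similarities"
  obtains r where "bij T" "r > 0" "\<And>x y. dist (T x) (T y) = r * dist x y"
  using assms unfolding similarities_def by blast

lemma rigid_motion_is_similarity: "T \<in> rigid_motions \<Longrightarrow> T \<in> similarities"
  unfolding similarities_def rigid_motions_def by (auto intro!: exI[of _ 1])

lemma id_similarity: "id \<in> similarities"
  by (rule rigid_motion_is_similarity) (simp add: rigid_motions_def)

lemma comp_similarity:
  assumes "S \<in> similarities" "T \<in> similarities"
  shows "S \<circ> T \<in> similarities"
proof -
  obtain r where r: "bij S" "r > 0" "\<And>x y. dist (S x) (S y) = r * dist x y"
    using assms(1) by (rule similarityE) blast
  obtain s where s: "bij T" "s > 0" "\<And>x y. dist (T x) (T y) = s * dist x y"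
    using assms(2) by (rule similarityE) blast
  have "bij (S \<circ> T)" using r(1) s(1) by (simp add: bij_comp)
  moreover have "\<forall>x y. dist ((S \<circ> T) x) ((S \<circ> T) y) = (r * s) * dist x y"
    using r(3) s(3) by simp
  moreover have "r * s > 0" using r(2) s(2) by simp
  ultimately show ?thesis unfolding similarities_def by blast
qed

lemma inv_similarity:
  assumes "T \<in> similarities"
  shows "inv T \<in> similarities"
proof -
  obtain r where r: "bij T" "r > 0" "\<And>x y. dist (T x) (T y) = r * dist x y"
    using assms by (rule similarityE) blast
  have "dist (inv T x) (inv T y) = (1 / r) * dist x y" for x y
    using r(3)[of "inv T x" "inv T y"] r(1,2) by (simp add: bij_is_surj surj_f_inv_f)
  moreover have "1 / r > 0" using r(2) by simp
  ultimately show ?thesis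
    unfolding similarities_def using bij_imp_bij_inv[OF r(1)] by blast
qed

lemma inv_similarity_apply:
  assumes "T \<in> similarities"
  shows "inv T (T x) = x" "T (inv T x) = x"
  using assms unfolding similarities_def
  by (auto simp: bij_is_inj bij_is_surj surj_f_inv_f)

lemma image_mset_inv_similarity:
  assumes "T \<in> similarities"
  shows "image_mset (inv T) (image_mset T P) = P"
  by (simp add: image_mset.compositionality comp_def inv_similarity_apply[OF assms])

section \<open>The centroid of a multiset\<close>

definition centroid :: "point multiset \<Rightarrow> point" where
  "centroid P = sum_mset P /\<^sub>R real (size P)"

text \<open>A map that scales all distances is affine, and affine maps preserve averages.\<close>

lemma centroid_similarity:
  assumes "T \<in> similarities" "P \<noteq> {#}"
  shows "centroid (image_mset T P) = T (centroid P)"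
proof -
  obtain r where r: "\<And>x y. dist (T x) (T y) = r * dist x y"
    using assms(1) by (rule similarityE) blast
  define L where "L x = T x - T 0" for x
  have lin: "linear L"
    by (rule scaling_linear[where c = r]) (simp_all add: L_def r[symmetric], simp add: dist_norm)
  have T: "T x = L x + T 0" for x by (simp add: L_def)
  have sum: "sum_mset (image_mset T Q) = L (sum_mset Q) + real (size Q) *\<^sub>R T 0" for Q
  proof (induction Q)
    case empty
    show ?case by (simp add: linear_0[OF lin])
  next
    case (add x Q)
    then show ?case
      by (simp add: T[of x] linear_add[OF lin] algebra_simps)
  qed
  have "real (size P) \<noteq> 0" using assms(2) by simp
  then show ?thesis
    by (simp add: centroid_def sum T[of "sum_mset P /\<^sub>R real (size P)"]
        linear_scale[OF lin] scaleR_add_right)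
qed

section \<open>Similarities that preserve a multiset\<close>

lemma point_reflection_rigid: "(\<lambda>x. 2 *\<^sub>R c - x) \<in> rigid_motions"
proof -
  have "bij (\<lambda>x::point. 2 *\<^sub>R c - x)"
    by (rule o_bij[where g = "\<lambda>x. 2 *\<^sub>R c - x"]) (auto simp: fun_eq_iff)
  then show ?thesis
    by (auto simp: rigid_motions_def dist_norm norm_minus_commute)
qed

text \<open>
  The group of symmetries consists of isometries only, but its fixed points are also fixed by the
  similarities that preserve \<open>P\<close>. A ratio other than one forces the distances to the centroid to
  add up to zero, and the point reflection in the centroid is available in that degenerate case.
\<close>

lemma similarity_stabilizer_fixes:
  assumes U: "U \<in> similarities" "image_mset U P = P" and P: "P \<noteq> {#}"
    and X: "X \<in> fixed_points (symmetries P)"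
  shows "U X = X"
proof -
  obtain r where r: "bij U" "\<And>x y. dist (U x) (U y) = r * dist x y"
    using U(1) by (rule similarityE) blast
  define c where "c = centroid P"
  have Uc: "U c = c" using centroid_similarity[OF U(1) P] U(2) by (simp add: c_def)
  define D where "D = (\<Sum>x\<in>#P. dist x c)"
  have "D = (\<Sum>x\<in>#image_mset U P. dist x c)" by (simp add: D_def U(2))
  also have "\<dots> = (\<Sum>x\<in>#P. dist (U x) (U c))"
    by (simp add: Uc image_mset.compositionality comp_def)
  also have "\<dots> = r * D" by (simp add: r(2) D_def sum_mset_distrib_left)
  finally have "r = 1 \<or> D = 0" by auto
  then show ?thesis
  proof
    assume "r = 1"
    then have "U \<in> symmetries P"
      using r U(2) by (simp add: symmetries_def rigid_motions_def)
    then show ?thesis using X by (simp add: fixed_points_def)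
  next
    assume D: "D = 0"
    have all_c: "x = c" if x: "x \<in># P" for x
    proof -
      obtain Q where Q: "P = add_mset x Q" using x by (meson multi_member_split)
      have "(\<Sum>y\<in>#Q. dist y c) \<ge> 0" by (induction Q) auto
      moreover have "dist x c + (\<Sum>y\<in>#Q. dist y c) = 0" using D by (simp add: D_def Q)
      ultimately have "dist x c \<le> 0" by linarith
      then show ?thesis by simp
    qed
    have "image_mset (\<lambda>x. 2 *\<^sub>R c - x) P = image_mset id P"
      by (rule image_mset_cong) (auto dest: all_c simp: scaleR_2)
    then have "(\<lambda>x. 2 *\<^sub>R c - x) \<in> symmetries P"
      using point_reflection_rigid by (simp add: symmetries_def)
    then have "2 *\<^sub>R c - X = X" using X by (auto simp: fixed_points_def)
    then have "2 *\<^sub>R c = 2 *\<^sub>R X" by (simp add: scaleR_2 algebra_simps)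
    then have "X = c" by simp
    then show ?thesis using Uc by simp
  qed
qed

section \<open>Prescribing a center on one orbit\<close>

text \<open>
  On the orbit of \<open>P\<close> the center with value \<open>X\<close> at \<open>P\<close> is the transport of \<open>X\<close> along any similarity
  that takes \<open>P\<close> to the given multiset.
\<close>

definition orbit_center :: "point multiset \<Rightarrow> point \<Rightarrow> point multiset \<Rightarrow> point" where
  "orbit_center P X Q =
     (if \<exists>T\<in>similarities. Q = image_mset T P
      then (SOME T. T \<in> similarities \<and> Q = image_mset T P) X
      else centroid Q)"

lemma orbit_center_on_orbit:
  assumes P: "P \<noteq> {#}" and X: "X \<in> fixed_points (symmetries P)" and T: "T \<in> similarities"
  shows "orbit_center P X (image_mset T P) = T X"
proof -
  define S where "S = (SOME S. S \<in> similarities \<and> image_mset T P = image_mset S P)"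
  have "S \<in> similarities \<and> image_mset T P = image_mset S P"
    unfolding S_def by (rule someI[of _ T]) (simp add: T)
  then have S: "S \<in> similarities" "image_mset T P = image_mset S P" by auto
  have "image_mset (inv T \<circ> S) P = P"
    by (simp add: S(2)[symmetric] image_mset_inv_similarity[OF T]
        image_mset.compositionality[symmetric])
  then have "(inv T \<circ> S) X = X"
    using similarity_stabilizer_fixes comp_similarity inv_similarity S(1) T P X by blast
  then have "S X = T X" using inv_similarity_apply(2)[OF T, of "S X"] by simp
  then show ?thesis using T by (auto simp: orbit_center_def S_def)
qed

lemma orbit_center_similarity:
  assumes P: "P \<noteq> {#}" and X: "X \<in> fixed_points (symmetries P)"
    and T: "T \<in> similarities" and Q: "Q \<noteq> {#}"
  shows "orbit_center P X (image_mset T Q) = T (orbit_center P X Q)"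
proof (cases "\<exists>S\<in>similarities. Q = image_mset S P")
  case True
  then obtain S where S: "S \<in> similarities" "Q = image_mset S P" by blast
  have "orbit_center P X (image_mset (T \<circ> S) P) = T (S X)"
    using orbit_center_on_orbit[OF P X comp_similarity[OF T S(1)]] by simp
  then show ?thesis
    using orbit_center_on_orbit[OF P X S(1)] by (simp add: S(2) image_mset.compositionality)
next
  case False
  have "\<not> (\<exists>S\<in>similarities. image_mset T Q = image_mset S P)"
  proof
    assume "\<exists>S\<in>similarities. image_mset T Q = image_mset S P"
    then obtain S where S: "S \<in> similarities" "image_mset T Q = image_mset S P" by blast
    have "Q = image_mset (inv T \<circ> S) P"
      using image_mset_inv_similarity[OF T, of Q] S(2)
      by (simp add: image_mset.compositionality)
    then show False using False comp_similarity[OF inv_similarity[OF T] S(1)] by blast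
  qed
  then show ?thesis using False centroid_similarity[OF T Q] by (simp add: orbit_center_def)
qed

section \<open>Centers and fixed points of the symmetry group\<close>

theorem theorem6:
  fixes n :: nat
  assumes "n \<ge> 1"
  shows "(\<forall>F Z P. multiset_center n F Z \<and> P \<in> F \<longrightarrow> Z P \<in> fixed_points (symmetries P)) \<and>
         (\<forall>P\<in>n_multisets n. \<forall>X\<in>fixed_points (symmetries P).
            \<exists>Z. multiset_center n (n_multisets n) Z \<and> Z P = X)"
proof (intro conjI allI impI ballI)
  fix F Z P
  assume FZP: "multiset_center n F Z \<and> P \<in> F"
  have "T (Z P) = Z P" if "T \<in> symmetries P" for T
  proof -
    have "T \<in> similarities" "image_mset T P = P"
      using that rigid_motion_is_similarity by (auto simp: symmetries_def)
    then show ?thesis using FZP unfolding multiset_center_def by metis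
  qed
  then show "Z P \<in> fixed_points (symmetries P)" by (simp add: fixed_points_def)
next
  fix P X
  assume P: "P \<in> n_multisets n" and X: "X \<in> fixed_points (symmetries P)"
  have nonempty: "Q \<noteq> {#}" if "Q \<in> n_multisets n" for Q
    using that assms by (auto simp: n_multisets_def)
  have "multiset_center n (n_multisets n) (orbit_center P X)"
    unfolding multiset_center_def
  proof (intro conjI ballI)
    show "n_multisets n \<noteq> {}" using P by blast
    show "n_multisets n \<subseteq> n_multisets n" by simp
    show "image_mset T Q \<in> n_multisets n" if "Q \<in> n_multisets n" for T Q
      using that by (simp add: n_multisets_def)
    show "orbit_center P X (image_mset T Q) = T (orbit_center P X Q)"
      if "T \<in> similarities" "Q \<in> n_multisets n" for T Q
      using orbit_center_similarity[OF nonempty[OF P] X] that nonempty by blast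
  qed
  moreover have "orbit_center P X P = X"
    using orbit_center_on_orbit[OF nonempty[OF P] X id_similarity] by simp
  ultimately show "\<exists>Z. multiset_center n (n_multisets n) Z \<and> Z P = X" by blast
qed

end
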